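(* Let $k$ be a positive integer and let $t$ be a binary tree pattern with $k$ leaves. Then $$g_{t}(x) = \frac{\sum\limits_{i=0}^{\lfloor \frac{k-2}{2} \rfloor} (-1)^{i}\binom{k-(i+2)}{i} x^{i+1}}{\sum\limits_{i=0}^{\lfloor \frac{k-1}{2} \rfloor}(-1)^{i}\binom{k-(i+1)}{i} x^{i}},$$ where an empty sum is $0$. In particular, $g_t(x)$ depends only on $k$ and not on the shape of $t$.
   Context: All trees are full binary trees: rooted, ordered (plane) trees in which every vertex has either $0$ children (a leaf) or exactly $2$ ordered children, a left child and a right child (an internal vertex). A binary tree pattern is such a tree. A tree $T$ contains a pattern $t$ (non-contiguously) if there is a tree $T^*$ obtained from $T$ by a finite sequence of edge contractions such that $t$ is a contiguous, rooted, ordered subtree of $T^*$; concretely, this means there is an injective map $\varphi$ from the vertices of $t$ to the vertices of $T$ such that for every internal vertex $u$ of $t$ with left child $u_1$ and right child $u_2$, $\varphi(u_1)$ lies in the subtree rooted at the left child of $\varphi(u)$ and $\varphi(u_2)$ lies in the subtree rooted at the right child of $\varphi(u)$. Otherwise $T$ avoids $t$. Let $\mathrm{av}_t(n)$ be the number of binary trees with $n$ leaves avoiding $t$, with the convention that there are no binary trees with $0$ leaves (so $\mathrm{av}_t(0)=0$), and let $g_t(x)=\sum_{n\ge 0}\mathrm{av}_t(n)x^n$. *)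

theory Defs
  imports "HOL-Computational_Algebra.Formal_Power_Series" "HOL-Library.Sublist"
begin

datatype btree = Leaf | Node btree btree

fun leaves :: "btree \<Rightarrow> nat" where
  "leaves Leaf = 1"
| "leaves (Node l r) = leaves l + leaves r"

text \<open>A vertex is encoded by its address, the path of left/right steps leading to it from the root.\<close>

datatype dir = L | R

fun vertices :: "btree \<Rightarrow> dir list set" where
  "vertices Leaf = {[]}"
| "vertices (Node l r) = insert [] (Cons L ` vertices l \<union> Cons R ` vertices r)"

fun internal_vertices :: "btree \<Rightarrow> dir list set" where
  "internal_vertices Leaf = {}"
| "internal_vertices (Node l r) =
     insert [] (Cons L ` internal_vertices l \<union> Cons R ` internal_vertices r)"

abbreviation left_child :: "dir list \<Rightarrow> dir list" where
  "left_child u \<equiv> u @ [L]"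

abbreviation right_child :: "dir list \<Rightarrow> dir list" where
  "right_child u \<equiv> u @ [R]"

text \<open>The result is empty if \<open>v\<close> is not a vertex of \<open>T\<close>; so requiring membership in the subtree
  at the left child of \<open>v\<close> entails that \<open>v\<close> is internal.\<close>

definition subtree_vertices :: "btree \<Rightarrow> dir list \<Rightarrow> dir list set" where
  "subtree_vertices T v = {w \<in> vertices T. prefix v w}"

definition contains :: "btree \<Rightarrow> btree \<Rightarrow> bool" where
  "contains T t \<longleftrightarrow>
     (\<exists>\<phi>. inj_on \<phi> (vertices t) \<and> \<phi> ` vertices t \<subseteq> vertices T \<and>
        (\<forall>u \<in> internal_vertices t.
           \<phi> (left_child u) \<in> subtree_vertices T (left_child (\<phi> u)) \<and>
           \<phi> (right_child u) \<in> subtree_vertices T (right_child (\<phi> u))))"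

abbreviation avoids :: "btree \<Rightarrow> btree \<Rightarrow> bool" where
  "avoids T t \<equiv> \<not> contains T t"

definition av :: "btree \<Rightarrow> nat \<Rightarrow> nat" where
  "av t n = card {T. leaves T = n \<and> avoids T t}"

definition avoid_gf :: "btree \<Rightarrow> rat fps" where
  "avoid_gf t = Abs_fps (\<lambda>n. of_nat (av t n))"

lemma leaves_pos: "leaves T > 0"
  by (induction T) auto

text \<open>The cardinality in \<open>av\<close> is that of a finite set.\<close>

lemma finite_leaves_eq: "finite {T. leaves T = n}"
proof (induction n rule: less_induct)
  case (less n)
  let ?S = "\<Union>i<n. {T. leaves T = i}"
  have "finite ?S" using less by auto
  then have "finite (insert Leaf (case_prod Node ` (?S \<times> ?S)))" by blast
  moreover have "{T. leaves T = n} \<subseteq> insert Leaf (case_prod Node ` (?S \<times> ?S))"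
  proof
    fix T assume "T \<in> {T. leaves T = n}"
    then show "T \<in> insert Leaf (case_prod Node ` (?S \<times> ?S))"
    proof (cases T)
      case (Node l r)
      then have "leaves l < n" "leaves r < n"
        using \<open>T \<in> {T. leaves T = n}\<close> leaves_pos[of l] leaves_pos[of r] by auto
      then show ?thesis using Node by auto
    qed simp
  qed
  ultimately show ?case by (rule rev_finite_subset)
qed

lemma av_0: "av t 0 = 0"
proof -
  have "{T. leaves T = 0 \<and> avoids T t} = {}"
    using leaves_pos by (metis (mono_tags, lifting) empty_Collect_eq less_numeral_extra(3))
  then show ?thesis by (simp only: av_def card.empty)
qed

end

theory Submission
  imports Defs
begin

text \<open>
  The avoiders of \<open>Node l r\<close> are the leaf and the trees \<open>Node A B\<close> where both \<open>A\<close> and \<open>B\<close> avoid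
  \<open>Node l r\<close> and, in addition, \<open>A\<close> avoids \<open>l\<close> or \<open>B\<close> avoids \<open>r\<close>. Inclusion-exclusion gives
  \<open>g\<^sub>t = x + g\<^sub>l g\<^sub>t + g\<^sub>t g\<^sub>r - g\<^sub>l g\<^sub>r\<close>. The Fibonacci-like polynomials with \<open>Q\<^sub>0 = 0\<close>,
  \<open>Q\<^sub>1 = 1\<close>, \<open>Q\<^sub>k\<^sub>+\<^sub>2 = Q\<^sub>k\<^sub>+\<^sub>1 - x Q\<^sub>k\<close> satisfy an addition formula from which
  \<open>Q\<^sub>k g\<^sub>t = x Q\<^sub>k\<^sub>-\<^sub>1\<close> follows by induction on \<open>t\<close>.
\<close>

section \<open>Pattern containment\<close>

text \<open>The left and right child conditions become one condition on \<open>u @ [d]\<close>. Only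
  the prefix part of \<open>subtree_vertices\<close> remains, because images are already required to
  be vertices of \<open>T\<close>.\<close>

definition embeds :: "(dir list \<Rightarrow> dir list) \<Rightarrow> btree \<Rightarrow> btree \<Rightarrow> bool" where
  "embeds \<phi> T t \<longleftrightarrow> inj_on \<phi> (vertices t) \<and> \<phi> ` vertices t \<subseteq> vertices T \<and>
     (\<forall>u d. u @ [d] \<in> vertices t \<longrightarrow> prefix (\<phi> u @ [d]) (\<phi> (u @ [d])))"

lemma Nil_in_vertices [simp]: "[] \<in> vertices T"
  by (cases T) auto

lemma Cons_in_vertices_Node [simp]:
  "L # w \<in> vertices (Node A B) \<longleftrightarrow> w \<in> vertices A"
  "R # w \<in> vertices (Node A B) \<longleftrightarrow> w \<in> vertices B"
  by auto

lemma snoc_in_vertices_iff: "u @ [d] \<in> vertices t \<longleftrightarrow> u \<in> internal_vertices t"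
proof (induction t arbitrary: u)
  case (Node l r)
  then show ?case by (cases u; cases "hd u"; cases d) auto
qed auto

lemma snoc_in_verticesD: "u @ [d] \<in> vertices t \<Longrightarrow> u \<in> vertices t"
proof -
  have "internal_vertices t \<subseteq> vertices t" by (induction t) auto
  then show "u @ [d] \<in> vertices t \<Longrightarrow> u \<in> vertices t"
    unfolding snoc_in_vertices_iff by blast
qed

lemma contains_iff_embeds: "contains T t \<longleftrightarrow> (\<exists>\<phi>. embeds \<phi> T t)"
proof -
  have "(\<forall>u \<in> internal_vertices t.
           \<phi> (left_child u) \<in> subtree_vertices T (left_child (\<phi> u)) \<and>
           \<phi> (right_child u) \<in> subtree_vertices T (right_child (\<phi> u))) \<longleftrightarrow>
        (\<forall>u d. u @ [d] \<in> vertices t \<longrightarrow> prefix (\<phi> u @ [d]) (\<phi> (u @ [d])))"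
    if "\<phi> ` vertices t \<subseteq> vertices T" for \<phi>
  proof -
    have "\<phi> (u @ [d]) \<in> vertices T" if "u \<in> internal_vertices t" for u d
      using that \<open>\<phi> ` vertices t \<subseteq> vertices T\<close> snoc_in_vertices_iff by blast
    moreover have "(\<forall>d. P d) \<longleftrightarrow> P L \<and> P R" for P
      by (metis dir.exhaust)
    ultimately show ?thesis
      by (auto simp: subtree_vertices_def snoc_in_vertices_iff)
  qed
  then show ?thesis
    unfolding contains_def embeds_def by (intro ex_cong1 conj_cong refl)
qed

lemma embeds_inj_on: "embeds \<phi> T t \<Longrightarrow> inj_on \<phi> (vertices t)"
  by (simp add: embeds_def)

lemma embeds_in_vertices: "embeds \<phi> T t \<Longrightarrow> u \<in> vertices t \<Longrightarrow> \<phi> u \<in> vertices T"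
  by (auto simp: embeds_def)

lemma embeds_snoc:
  "embeds \<phi> T t \<Longrightarrow> u @ [d] \<in> vertices t \<Longrightarrow> prefix (\<phi> u @ [d]) (\<phi> (u @ [d]))"
  by (simp add: embeds_def)

text \<open>The child condition, chained along the path \<open>v\<close>, shows that descendants are
  mapped to descendants.\<close>

lemma embeds_prefix:
  assumes "embeds \<phi> T t" "u @ v \<in> vertices t"
  shows "prefix (\<phi> u) (\<phi> (u @ v))"
  using assms(2)
proof (induction v rule: rev_induct)
  case (snoc d v)
  have "u @ v \<in> vertices t"
    using snoc.prems snoc_in_verticesD[of "u @ v" d t] by simp
  then have "prefix (\<phi> u) (\<phi> (u @ v))" by (rule snoc.IH)
  also have "prefix (\<phi> (u @ v)) (\<phi> (u @ v) @ [d])" by simp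
  also have "prefix (\<phi> (u @ v) @ [d]) (\<phi> ((u @ v) @ [d]))"
    using snoc.prems by (intro embeds_snoc[OF assms(1)]) simp
  finally show ?case by simp
qed simp

lemma embeds_restrict:
  assumes "embeds \<phi> T t" "\<And>w. w \<in> vertices s \<Longrightarrow> d # w \<in> vertices t"
  shows "embeds (\<lambda>w. \<phi> (d # w)) T s"
  unfolding embeds_def
proof (intro conjI allI impI)
  show "inj_on (\<lambda>w. \<phi> (d # w)) (vertices s)"
    using embeds_inj_on[OF assms(1)] assms(2) by (auto simp: inj_on_def)
  show "(\<lambda>w. \<phi> (d # w)) ` vertices s \<subseteq> vertices T"
    using embeds_in_vertices[OF assms(1)] assms(2) by blast
  fix u e assume "u @ [e] \<in> vertices s"
  then have "(d # u) @ [e] \<in> vertices t" using assms(2) by simp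
  then have "prefix (\<phi> (d # u) @ [e]) (\<phi> ((d # u) @ [e]))"
    by (rule embeds_snoc[OF assms(1)])
  then show "prefix (\<phi> (d # u) @ [e]) (\<phi> (d # (u @ [e])))" by simp
qed

text \<open>If the whole image lies below child \<open>d\<close> of the root, deleting the common
  first letter gives an embedding into the subtree \<open>S\<close> hanging there.\<close>

lemma embeds_below:
  assumes "embeds \<phi> T t" "\<And>u. u \<in> vertices t \<Longrightarrow> prefix [d] (\<phi> u)"
    and "\<And>w. d # w \<in> vertices T \<Longrightarrow> w \<in> vertices S"
  shows "embeds (\<lambda>u. tl (\<phi> u)) S t"
proof -
  have cons: "\<exists>w. \<phi> u = d # w" if "u \<in> vertices t" for u
    using assms(2)[OF that] by (cases "\<phi> u") auto
  show ?thesis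
    unfolding embeds_def
  proof (intro conjI allI impI)
    show "inj_on (\<lambda>u. tl (\<phi> u)) (vertices t)"
    proof (rule inj_onI)
      fix u v assume uv: "u \<in> vertices t" "v \<in> vertices t" "tl (\<phi> u) = tl (\<phi> v)"
      obtain x y where "\<phi> u = d # x" "\<phi> v = d # y"
        using cons[OF uv(1)] cons[OF uv(2)] by blast
      then have "\<phi> u = \<phi> v" using uv(3) by simp
      then show "u = v" using inj_onD[OF embeds_inj_on[OF assms(1)]] uv by blast
    qed
    show "(\<lambda>u. tl (\<phi> u)) ` vertices t \<subseteq> vertices S"
    proof (rule image_subsetI)
      fix u assume u: "u \<in> vertices t"
      obtain w where "\<phi> u = d # w" using cons[OF u] by blast
      then show "tl (\<phi> u) \<in> vertices S"
        using embeds_in_vertices[OF assms(1) u] assms(3) by simp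
    qed
    fix u e assume ue: "u @ [e] \<in> vertices t"
    obtain v w where "\<phi> u = d # v" "\<phi> (u @ [e]) = d # w"
      using cons[OF snoc_in_verticesD[OF ue]] cons[OF ue] by blast
    then show "prefix (tl (\<phi> u) @ [e]) (tl (\<phi> (u @ [e])))"
      using embeds_snoc[OF assms(1) ue] by simp
  qed
qed

section \<open>Recursion for containment\<close>

lemma contains_Leaf [simp]: "contains T Leaf"
  unfolding contains_iff_embeds embeds_def by (intro exI[of _ "\<lambda>_. []"]) auto

lemma not_contains_Leaf_Node [simp]: "\<not> contains Leaf (Node l r)"
proof
  assume "contains Leaf (Node l r)"
  then obtain \<phi> where \<phi>: "embeds \<phi> Leaf (Node l r)" unfolding contains_iff_embeds ..
  have L: "[] @ [L] \<in> vertices (Node l r)" by simp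
  have "\<phi> ([] @ [L]) = []" using embeds_in_vertices[OF \<phi> L] by simp
  then show False using embeds_snoc[OF \<phi> L] by simp
qed

lemma contains_Node_left:
  assumes "contains A t" shows "contains (Node A B) t"
proof -
  obtain \<phi> where "embeds \<phi> A t" using assms unfolding contains_iff_embeds ..
  then have "embeds (\<lambda>u. L # \<phi> u) (Node A B) t"
    unfolding embeds_def inj_on_def by auto
  then show ?thesis unfolding contains_iff_embeds by blast
qed

lemma contains_Node_right:
  assumes "contains B t" shows "contains (Node A B) t"
proof -
  obtain \<phi> where "embeds \<phi> B t" using assms unfolding contains_iff_embeds ..
  then have "embeds (\<lambda>u. R # \<phi> u) (Node A B) t"
    unfolding embeds_def inj_on_def by auto
  then show ?thesis unfolding contains_iff_embeds by blast
qed

lemma contains_Node_Node: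
  assumes "contains A l" "contains B r" shows "contains (Node A B) (Node l r)"
proof -
  obtain \<alpha> \<beta> where \<alpha>: "embeds \<alpha> A l" and \<beta>: "embeds \<beta> B r"
    using assms unfolding contains_iff_embeds by blast
  \<comment> \<open>The two embeddings are glued by sending root to root.\<close>
  define \<phi> where "\<phi> u = (case u of [] \<Rightarrow> [] | L # w \<Rightarrow> L # \<alpha> w | R # w \<Rightarrow> R # \<beta> w)" for u
  have \<phi>_simps [simp]: "\<phi> [] = []" "\<phi> (L # w) = L # \<alpha> w" "\<phi> (R # w) = R # \<beta> w" for w
    by (simp_all add: \<phi>_def)
  have "inj_on \<phi> (vertices (Node l r))"
    using \<alpha> \<beta> unfolding embeds_def inj_on_def by auto
  moreover have "\<phi> ` vertices (Node l r) \<subseteq> vertices (Node A B)"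
    using \<alpha> \<beta> unfolding embeds_def by auto
  moreover have "prefix (\<phi> u @ [d]) (\<phi> (u @ [d]))" if "u @ [d] \<in> vertices (Node l r)" for u d
  proof (cases u)
    case Nil
    then show ?thesis by (cases d) auto
  next
    case (Cons e w)
    then show ?thesis using \<alpha> \<beta> that unfolding embeds_def by (cases e) auto
  qed
  ultimately have "embeds \<phi> (Node A B) (Node l r)" unfolding embeds_def by blast
  then show ?thesis unfolding contains_iff_embeds by blast
qed

text \<open>The image of the pattern's root decides the case: if it is the root, \<open>l\<close>
  goes into \<open>A\<close> and \<open>r\<close> into \<open>B\<close>; otherwise the whole image
  lies below one child of the root.\<close>

lemma contains_Node_iff:
  "contains (Node A B) (Node l r) \<longleftrightarrow>
     contains A (Node l r) \<or> contains B (Node l r) \<or> contains A l \<and> contains B r"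
proof
  let ?t = "Node l r"
  assume "contains (Node A B) ?t"
  then obtain \<phi> where \<phi>: "embeds \<phi> (Node A B) ?t" unfolding contains_iff_embeds ..
  have root: "prefix (\<phi> []) (\<phi> u)" if "u \<in> vertices ?t" for u
    using embeds_prefix[OF \<phi>, of "[]" u] that by simp
  show "contains A ?t \<or> contains B ?t \<or> contains A l \<and> contains B r"
  proof (cases "\<phi> []")
    case Nil
    \<comment> \<open>Since the root is fixed, child \<open>d\<close> lands below child
      \<open>d\<close> of the root, and its descendants follow.\<close>
    have "prefix [d] (\<phi> (d # w))" if "d # w \<in> vertices ?t" for d w
    proof -
      have "[] @ [d] \<in> vertices ?t" by (cases d) auto
      then have "prefix (\<phi> [] @ [d]) (\<phi> ([] @ [d]))"
        by (rule embeds_snoc[OF \<phi>])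
      moreover have "prefix (\<phi> [d]) (\<phi> (d # w))"
        using embeds_prefix[OF \<phi>, of "[d]" w] that by simp
      ultimately show ?thesis using Nil prefix_order.trans by simp
    qed
    then have "embeds (\<lambda>w. tl (\<phi> (L # w))) A l" "embeds (\<lambda>w. tl (\<phi> (R # w))) B r"
      using embeds_below[OF embeds_restrict[OF \<phi>, of l L], of L A]
        embeds_below[OF embeds_restrict[OF \<phi>, of r R], of R B]
      by auto
    then show ?thesis unfolding contains_iff_embeds by blast
  next
    case (Cons d w)
    have "prefix [d] (\<phi> u)" if "u \<in> vertices ?t" for u
      using root[OF that] Cons by (auto simp: prefix_def)
    then have "embeds (\<lambda>u. tl (\<phi> u)) (case d of L \<Rightarrow> A | R \<Rightarrow> B) ?t"
      by (intro embeds_below[OF \<phi>, of d]) (auto split: dir.splits)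
    then show ?thesis unfolding contains_iff_embeds by (cases d) auto
  qed
qed (auto intro: contains_Node_left contains_Node_right contains_Node_Node)

text \<open>In terms of avoiders: avoiding \<open>l\<close> or avoiding \<open>r\<close> already
  forces avoiding \<open>Node l r\<close>.\<close>

lemma contains_Node_imp_contains_children:
  "contains T (Node l r) \<Longrightarrow> contains T l \<and> contains T r"
proof (induction T)
  case (Node A B)
  then show ?case
    unfolding contains_Node_iff[of A B l r] using contains_Node_left contains_Node_right by blast
qed simp

section \<open>Generating functions of sets of trees\<close>

unbundle fps_syntax

definition leaf_gf :: "btree set \<Rightarrow> 'a :: comm_ring_1 fps" where
  "leaf_gf S = Abs_fps (\<lambda>n. of_nat (card {T \<in> S. leaves T = n}))"

lemma finite_leaves_eq_in: "finite {T \<in> S. leaves T = n}"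
  by (rule finite_subset[OF _ finite_leaves_eq[of n]]) auto

text \<open>Inclusion-exclusion in each coefficient, kept additive so that no natural number
  subtraction occurs.\<close>

lemma leaf_gf_Un_Int:
  "(leaf_gf (S \<union> S') :: 'a :: comm_ring_1 fps) + leaf_gf (S \<inter> S') = leaf_gf S + leaf_gf S'"
proof (rule fps_ext)
  fix n
  let ?F = "\<lambda>S. {T \<in> S. leaves T = n}"
  have "?F (S \<union> S') = ?F S \<union> ?F S'" "?F (S \<inter> S') = ?F S \<inter> ?F S'" by auto
  then have "card (?F (S \<union> S')) + card (?F (S \<inter> S')) = card (?F S) + card (?F S')"
    by (simp only: card_Un_Int[OF finite_leaves_eq_in finite_leaves_eq_in])
  then have "of_nat (card (?F (S \<union> S')) + card (?F (S \<inter> S'))) =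
      (of_nat (card (?F S) + card (?F S')) :: 'a)"
    by (rule arg_cong)
  then show "(leaf_gf (S \<union> S') + leaf_gf (S \<inter> S')) $ n =
      (leaf_gf S + leaf_gf S' :: 'a fps) $ n"
    unfolding leaf_gf_def fps_add_nth fps_nth_Abs_fps of_nat_add .
qed

lemma leaf_gf_empty [simp]: "leaf_gf {} = 0"
  by (rule fps_ext) (simp add: leaf_gf_def)

lemma leaf_gf_Leaf [simp]: "leaf_gf {Leaf} = fps_X"
proof (rule fps_ext)
  fix n
  have "{T \<in> {Leaf}. leaves T = n} = (if n = 1 then {Leaf} else {})" by auto
  then show "leaf_gf {Leaf} $ n = fps_X $ n"
    unfolding leaf_gf_def fps_nth_Abs_fps by simp
qed

lemma inj_Node: "inj_on (case_prod Node) S"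
  by (auto simp: inj_on_def)

lemma Node_in_image_iff [simp]: "Node A B \<in> case_prod Node ` X \<longleftrightarrow> (A, B) \<in> X"
  by auto

lemma Leaf_notin_image [simp]: "Leaf \<notin> case_prod Node ` X"
  by auto

text \<open>Splitting by the number \<open>i\<close> of leaves of the left subtree turns the count
  into a Cauchy product.\<close>

lemma leaf_gf_Node_image:
  "leaf_gf (case_prod Node ` (S \<times> S')) = leaf_gf S * leaf_gf S'"
proof (rule fps_ext)
  fix n
  let ?F = "\<lambda>S n. {T \<in> S. leaves T = n}"
  have "?F (case_prod Node ` (S \<times> S')) n =
      case_prod Node ` (\<Union>i\<in>{0..n}. ?F S i \<times> ?F S' (n - i))"
  proof (rule set_eqI)
    fix T
    show "T \<in> ?F (case_prod Node ` (S \<times> S')) n \<longleftrightarrow>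
        T \<in> case_prod Node ` (\<Union>i\<in>{0..n}. ?F S i \<times> ?F S' (n - i))"
      by (cases T) (auto simp del: image_UN)
  qed
  then have "card (?F (case_prod Node ` (S \<times> S')) n) =
      card (\<Union>i\<in>{0..n}. ?F S i \<times> ?F S' (n - i))"
    by (simp add: card_image inj_Node)
  also have "\<dots> = (\<Sum>i\<in>{0..n}. card (?F S i \<times> ?F S' (n - i)))"
    by (rule card_UN_disjoint) (auto simp: finite_leaves_eq_in)
  finally show "leaf_gf (case_prod Node ` (S \<times> S')) $ n = (leaf_gf S * leaf_gf S') $ n"
    by (simp add: leaf_gf_def fps_mult_nth card_cartesian_product)
qed

section \<open>Functional equation for avoiders\<close>

lemma avoid_gf_eq_leaf_gf: "avoid_gf t = leaf_gf {T. avoids T t}"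
  unfolding avoid_gf_def leaf_gf_def av_def by (simp add: conj_commute)

lemma avoid_gf_Leaf: "avoid_gf Leaf = 0"
  by (simp add: avoid_gf_eq_leaf_gf)

lemma avoid_gf_Node:
  "avoid_gf (Node l r) = fps_X + avoid_gf l * avoid_gf (Node l r)
     + avoid_gf (Node l r) * avoid_gf r - avoid_gf l * avoid_gf r"
proof -
  let ?t = "Node l r"
  let ?A = "\<lambda>s. {T. avoids T s}" and ?N = "\<lambda>S. case_prod Node ` S"
  let ?U = "?N (?A l \<times> ?A ?t)" and ?V = "?N (?A ?t \<times> ?A r)"
  have sub: "?A l \<subseteq> ?A ?t" "?A r \<subseteq> ?A ?t"
    using contains_Node_imp_contains_children by blast+
  have "?A ?t = {Leaf} \<union> (?U \<union> ?V)"
  proof (rule set_eqI)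
    fix T
    show "T \<in> ?A ?t \<longleftrightarrow> T \<in> {Leaf} \<union> (?U \<union> ?V)"
    proof (cases T)
      case (Node A B)
      have "Node A B \<in> ?A ?t \<longleftrightarrow>
          A \<in> ?A ?t \<and> B \<in> ?A ?t \<and> (A \<in> ?A l \<or> B \<in> ?A r)"
        by (simp add: contains_Node_iff)
      \<comment> \<open>By \<open>sub\<close>, avoiding a child pattern absorbs the condition of
        avoiding \<open>?t\<close>, which leaves a union of two products.\<close>
      also have "\<dots> \<longleftrightarrow> A \<in> ?A l \<and> B \<in> ?A ?t \<or> A \<in> ?A ?t \<and> B \<in> ?A r"
        using subsetD[OF sub(1), of A] subsetD[OF sub(2), of B] by argo
      also have "\<dots> \<longleftrightarrow> Node A B \<in> {Leaf} \<union> (?U \<union> ?V)"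
        by simp
      finally show ?thesis unfolding Node .
    qed simp
  qed
  then have "avoid_gf ?t = leaf_gf ({Leaf} \<union> (?U \<union> ?V))"
    unfolding avoid_gf_eq_leaf_gf by (rule arg_cong)
  also have "{Leaf} \<inter> (?U \<union> ?V) = {}"
    by auto
  then have "leaf_gf ({Leaf} \<union> (?U \<union> ?V)) = fps_X + (leaf_gf (?U \<union> ?V) :: rat fps)"
    using leaf_gf_Un_Int[of "{Leaf}" "?U \<union> ?V", where 'a = rat] by simp
  also have "leaf_gf (?U \<union> ?V) =
      leaf_gf ?U + leaf_gf ?V - (leaf_gf (?U \<inter> ?V) :: rat fps)"
    unfolding eq_diff_eq by (rule leaf_gf_Un_Int)
  also have "?U \<inter> ?V = ?N ((?A l \<times> ?A ?t) \<inter> (?A ?t \<times> ?A r))"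
    by (rule image_Int[OF inj_Node, symmetric])
  also have "(?A l \<times> ?A ?t) \<inter> (?A ?t \<times> ?A r) = ?A l \<times> ?A r"
    using sub by (simp only: Times_Int_Times inf_absorb1 inf_absorb2)
  finally show ?thesis
    unfolding leaf_gf_Node_image avoid_gf_eq_leaf_gf[symmetric] by (simp add: algebra_simps)
qed

section \<open>The Fibonacci-like polynomials\<close>

fun fib_fps :: "nat \<Rightarrow> 'a :: comm_ring_1 fps" where
  "fib_fps 0 = 0"
| "fib_fps (Suc 0) = 1"
| "fib_fps (Suc (Suc k)) = fib_fps (Suc k) - fps_X * fib_fps k"

text \<open>The analogue of the Fibonacci addition formula: as functions of \<open>b\<close>, both
  sides satisfy the same recurrence and agree at 0 and 1.\<close>

lemma fib_fps_add:
  "(fib_fps (Suc (a + b)) :: 'a :: comm_ring_1 fps) =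
     fib_fps (Suc a) * fib_fps (Suc b) - fps_X * fib_fps a * fib_fps b"
proof (induction b rule: fib_fps.induct)
  case (3 k)
  have "(fib_fps (Suc (a + Suc (Suc k))) :: 'a fps) =
      fib_fps (Suc (a + Suc k)) - fps_X * fib_fps (Suc (a + k))"
    by simp
  then show ?case unfolding "3.IH" by (simp add: algebra_simps)
qed simp_all

lemma fib_fps_Suc_nth:
  "(fib_fps (Suc m) :: 'a :: comm_ring_1 fps) $ n = (-1) ^ n * of_nat ((m - n) choose n)"
proof (induction m arbitrary: n rule: fib_fps.induct)
  case 1
  then show ?case by (cases n) auto
next
  case 2
  then show ?case by (cases n; cases "n - 1") auto
next
  case (3 k)
  show ?case
  proof (cases n)
    case (Suc j)
    \<comment> \<open>Pascal's rule; for \<open>j > k\<close> the subtractions truncate to 0 and all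
      three binomials vanish.\<close>
    have "(Suc (Suc k) - n) choose n = ((Suc k - n) choose n) + ((k - j) choose j)"
    proof (cases "j \<le> k")
      case True
      then show ?thesis using Suc by (simp add: Suc_diff_le)
    qed (use Suc in auto)
    moreover have "(fib_fps (Suc (Suc (Suc k))) :: 'a fps) $ n =
        fib_fps (Suc (Suc k)) $ n - fib_fps (Suc k) $ j"
      by (simp only: fib_fps.simps(3)[of "Suc k"] fps_sub_nth fps_X_mult_nth Suc) simp
    ultimately show ?thesis
      by (simp only: "3.IH") (simp add: Suc algebra_simps)
  qed (use "3.IH" in simp)
qed

text \<open>The sum may stop at \<open>m div 2\<close>, since beyond it the lower binomial index
  exceeds the upper one.\<close>

lemma fib_fps_Suc_eq_sum:
  "(fib_fps (Suc m) :: 'a :: comm_ring_1 fps) =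
     (\<Sum>i\<le>m div 2. (-1) ^ i * of_nat ((m - i) choose i) * fps_X ^ i)"
proof (rule fps_ext)
  fix n
  have term_nth: "((-1) ^ i * of_nat c * fps_X ^ i :: 'a fps) $ n =
      (if n = i then (-1) ^ n * of_nat c else 0)" for i c
  proof -
    \<comment> \<open>Sign and binomial are collected into one constant series, so that each term is
      a visible monomial.\<close>
    have "(- 1 :: 'a fps) = fps_const (- 1)"
      by (simp flip: fps_const_neg)
    then have "((-1) ^ i * of_nat c :: 'a fps) = fps_const ((-1) ^ i * of_nat c)"
      by (simp only: fps_const_power fps_const_mult flip: fps_of_nat)
    then show ?thesis by simp
  qed
  have "m - n < n" if "\<not> n \<le> m div 2"
    using that by linarith
  then show "fib_fps (Suc m) $ n =
      (\<Sum>i\<le>m div 2. (-1) ^ i * of_nat ((m - i) choose i) * fps_X ^ i :: 'a fps) $ n"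
    by (cases "n \<le> m div 2") (simp_all add: fps_sum_nth term_nth fib_fps_Suc_nth binomial_eq_0)
qed

text \<open>The product form keeps the induction within ring identities; division is left to the
  end.\<close>

lemma fib_fps_mult_avoid_gf:
  "fib_fps (leaves t) * avoid_gf t = fps_X * fib_fps (leaves t - 1)"
proof (induction t)
  case Leaf
  show ?case by (simp add: avoid_gf_Leaf)
next
  case (Node l r)
  obtain a b where ab: "leaves l = Suc a" "leaves r = Suc b"
    using leaves_pos by (metis gr0_implies_Suc)
  let ?Q = "fib_fps :: nat \<Rightarrow> rat fps"
  let ?g = "avoid_gf (Node l r)"
  have l: "?Q (Suc a) * avoid_gf l = fps_X * ?Q a"
    and r: "?Q (Suc b) * avoid_gf r = fps_X * ?Q b"
    using Node.IH ab by simp_all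
  \<comment> \<open>The addition formula at \<open>a\<close> and \<open>Suc b\<close>, with one step
    of the recurrence applied to the factor of index \<open>Suc (Suc b)\<close>.\<close>
  have Q: "?Q (Suc (Suc (a + b))) =
      ?Q (Suc a) * ?Q (Suc b) - fps_X * ?Q (Suc a) * ?Q b - fps_X * ?Q a * ?Q (Suc b)"
    using fib_fps_add[of a "Suc b", where 'a = rat] by (simp add: algebra_simps)
  have g: "?g * (1 - avoid_gf l - avoid_gf r) = fps_X - avoid_gf l * avoid_gf r"
    using avoid_gf_Node[of l r] by (simp add: algebra_simps)
  \<comment> \<open>The induction hypotheses, read from right to left, replace
    \<open>fps_X * ?Q a\<close> and \<open>fps_X * ?Q b\<close> in \<open>Q\<close> and expose the
    coefficient of \<open>?g\<close> from \<open>g\<close>.\<close>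
  have factor: "?Q (Suc (Suc (a + b))) =
      ?Q (Suc a) * ?Q (Suc b) * (1 - avoid_gf l - avoid_gf r)"
  proof -
    have "?Q (Suc (Suc (a + b))) = ?Q (Suc a) * ?Q (Suc b)
        - ?Q (Suc b) * (?Q (Suc a) * avoid_gf l) - ?Q (Suc a) * (?Q (Suc b) * avoid_gf r)"
      unfolding Q l r by (simp add: algebra_simps)
    then show ?thesis by (simp only: right_diff_distrib mult_1_left mult_1_right mult_ac)
  qed
  have "?Q (Suc (Suc (a + b))) * ?g =
      ?Q (Suc a) * ?Q (Suc b) * (?g * (1 - avoid_gf l - avoid_gf r))"
    unfolding factor by (simp only: mult_ac)
  also have "\<dots> = fps_X * (?Q (Suc a) * ?Q (Suc b))
      - (?Q (Suc a) * avoid_gf l) * (?Q (Suc b) * avoid_gf r)"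
    unfolding g by (simp add: algebra_simps)
  \<comment> \<open>After the induction hypotheses are inserted, this is \<open>fps_X\<close> times
    the addition formula at \<open>a\<close> and \<open>b\<close>.\<close>
  also have "\<dots> = fps_X * ?Q (Suc (a + b))"
    unfolding l r fib_fps_add by (simp add: algebra_simps)
  finally show ?case by (simp add: ab)
qed

lemma avoid_gf_eq_divide:
  "avoid_gf t = fps_X * fib_fps (leaves t - 1) / fib_fps (leaves t)"
proof -
  obtain m where "leaves t = Suc m" using leaves_pos gr0_implies_Suc by blast
  \<comment> \<open>Its constant coefficient is 1.\<close>
  then have "(fib_fps (leaves t) :: rat fps) \<noteq> 0"
    using fib_fps_Suc_nth[of m 0, where 'a = rat] by (metis binomial_n_0 fps_zero_nth
        mult_1 of_nat_1 power_0 zero_neq_one)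
  then show ?thesis
    using fib_fps_mult_avoid_gf[of t] by (metis nonzero_mult_div_cancel_left)
qed

theorem theorem1:
  fixes k :: nat and t :: btree
  assumes "k > 0" and "leaves t = k"
  shows "avoid_gf t =
      (\<Sum>i | int i \<le> \<lfloor>(real k - 2) / 2\<rfloor>.
         (-1) ^ i * of_nat ((k - (i + 2)) choose i) * fps_X ^ (i + 1)) /
      (\<Sum>i | int i \<le> \<lfloor>(real k - 1) / 2\<rfloor>.
         (-1) ^ i * of_nat ((k - (i + 1)) choose i) * fps_X ^ i)
    \<and> (\<forall>s. leaves s = k \<longrightarrow> avoid_gf s = avoid_gf t)"
proof -
  have index: "{i. int i \<le> \<lfloor>real m / 2\<rfloor>} = {..m div 2}" for m
    by (auto simp: le_floor_iff)
  obtain m where m: "k = Suc m" using assms(1) gr0_implies_Suc by blast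
  have denominator: "(\<Sum>i | int i \<le> \<lfloor>(real k - 1) / 2\<rfloor>.
      (-1) ^ i * of_nat ((k - (i + 1)) choose i) * fps_X ^ i) = (fib_fps k :: rat fps)"
    using index[of m] by (simp add: m fib_fps_Suc_eq_sum)
  have numerator: "(\<Sum>i | int i \<le> \<lfloor>(real k - 2) / 2\<rfloor>.
      (-1) ^ i * of_nat ((k - (i + 2)) choose i) * fps_X ^ (i + 1)) =
      (fps_X * fib_fps (k - 1) :: rat fps)"
  proof (cases m)
    case 0
    \<comment> \<open>For \<open>k = 1\<close> the bound is the floor of -1/2, which is -1; the
      empty sum matches \<open>fib_fps 0 = 0\<close>.\<close>
    have "{i. int i \<le> \<lfloor>(real k - 2) / 2\<rfloor>} = {}"
      by (auto simp: m 0 le_floor_iff)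
    then show ?thesis by (simp add: m 0)
  next
    case (Suc j)
    then show ?thesis
      using index[of j] by (simp add: m fib_fps_Suc_eq_sum sum_distrib_left mult_ac)
  qed
  \<comment> \<open>The quotient involves the tree only through \<open>leaves\<close>, which also
    gives independence of the shape.\<close>
  show ?thesis
    unfolding numerator denominator using avoid_gf_eq_divide assms(2) by metis
qed

end
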